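(* Each $\aleph_0$-monolithic space is $CC$-Maslyuchenko. Consequently, the class of $CC$-Maslyuchenko spaces contains all $k^*$-metrizable spaces and all $\aleph$-spaces.
   Context: Regular spaces are understood to be Hausdorff. A family $\mathcal N$ of subsets of a topological space $X$ is a $k$-network if for any compact $K\subset X$ and any neighborhood $O_K\subset X$ of $K$ there is a finite subfamily $\mathcal F\subset\mathcal N$ with $K\subset\bigcup\mathcal F\subset O_K$. A regular space is: an $\aleph_0$-space if it has a countable $k$-network; an $\aleph$-space if it has a $\sigma$-locally finite $k$-network; $k^*$-metrizable if it has a $\sigma$-compact-finite $k$-network (a family is compact-finite if each compact set meets only finitely many of its members, and $\sigma$-compact-finite if it is a countable union of compact-finite families). The sequential closure $\mathrm{cl}_1(A)$ of a subset $A$ of a topological space $X$ is the set of limit points of sequences $\{a_n\}_{n\in\omega}\subset A$ that converge in $X$. A regular space $X$ is $\aleph_0$-monolithic if each countable subspace of $X$ is an $\aleph_0$-space and for each $\aleph_0$-subspace $A\subset X$ the sequential closure $\mathrm{cl}_1(A)$ in $X$ is an $\aleph_0$-space. A topological space $Z$ is $CC$-Maslyuchenko if for all separable metrizable spaces $X,Y$ and every separately continuous function $f:X\times Y\to Z$ the set $D(f)\subset X\times Y$ of discontinuity points of $f$ has meager projections on $X$ and on $Y$ (meager = countable union of nowhere dense sets). *)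

theory Defs
  imports "HOL-Analysis.Analysis"
begin

(* Neighborhoods are not required to be open. *)
definition k_network :: "'a topology \<Rightarrow> 'a set set \<Rightarrow> bool" where
  "k_network X \<N> \<longleftrightarrow>
     \<Union>\<N> \<subseteq> topspace X \<and>
     (\<forall>K U. compactin X K \<and> U \<subseteq> topspace X \<and> K \<subseteq> X interior_of U \<longrightarrow>
        (\<exists>\<F>. finite \<F> \<and> \<F> \<subseteq> \<N> \<and> K \<subseteq> \<Union>\<F> \<and> \<Union>\<F> \<subseteq> U))"

definition compact_finite_in :: "'a topology \<Rightarrow> 'a set set \<Rightarrow> bool" where
  "compact_finite_in X \<A> \<longleftrightarrow>
     \<Union>\<A> \<subseteq> topspace X \<and>
     (\<forall>K. compactin X K \<longrightarrow> finite {A \<in> \<A>. A \<inter> K \<noteq> {}})"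

definition sigma_locally_finite_in :: "'a topology \<Rightarrow> 'a set set \<Rightarrow> bool" where
  "sigma_locally_finite_in X \<A> \<longleftrightarrow>
     (\<exists>\<F> :: nat \<Rightarrow> 'a set set. (\<forall>n. locally_finite_in X (\<F> n)) \<and> \<A> = (\<Union>n. \<F> n))"

definition sigma_compact_finite_in :: "'a topology \<Rightarrow> 'a set set \<Rightarrow> bool" where
  "sigma_compact_finite_in X \<A> \<longleftrightarrow>
     (\<exists>\<F> :: nat \<Rightarrow> 'a set set. (\<forall>n. compact_finite_in X (\<F> n)) \<and> \<A> = (\<Union>n. \<F> n))"

(* Regular spaces are understood to be Hausdorff, which regular_space does not include. *)
definition regular_Hausdorff_space :: "'a topology \<Rightarrow> bool" where
  "regular_Hausdorff_space X \<longleftrightarrow> regular_space X \<and> Hausdorff_space X"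

definition aleph0_space :: "'a topology \<Rightarrow> bool" where
  "aleph0_space X \<longleftrightarrow> regular_Hausdorff_space X \<and> (\<exists>\<N>. k_network X \<N> \<and> countable \<N>)"

definition aleph_space :: "'a topology \<Rightarrow> bool" where
  "aleph_space X \<longleftrightarrow>
     regular_Hausdorff_space X \<and> (\<exists>\<N>. k_network X \<N> \<and> sigma_locally_finite_in X \<N>)"

definition k_star_metrizable_space :: "'a topology \<Rightarrow> bool" where
  "k_star_metrizable_space X \<longleftrightarrow>
     regular_Hausdorff_space X \<and> (\<exists>\<N>. k_network X \<N> \<and> sigma_compact_finite_in X \<N>)"

definition sequential_closure_of :: "'a topology \<Rightarrow> 'a set \<Rightarrow> 'a set" where
  "sequential_closure_of X A =
     {l. \<exists>a :: nat \<Rightarrow> 'a. range a \<subseteq> A \<and> limitin X a l sequentially}"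

definition aleph0_monolithic_space :: "'a topology \<Rightarrow> bool" where
  "aleph0_monolithic_space X \<longleftrightarrow>
     regular_Hausdorff_space X \<and>
     (\<forall>A. A \<subseteq> topspace X \<and> countable A \<longrightarrow> aleph0_space (subtopology X A)) \<and>
     (\<forall>A. A \<subseteq> topspace X \<and> aleph0_space (subtopology X A) \<longrightarrow>
        aleph0_space (subtopology X (sequential_closure_of X A)))"

definition nowhere_dense_in :: "'a topology \<Rightarrow> 'a set \<Rightarrow> bool" where
  "nowhere_dense_in X A \<longleftrightarrow> A \<subseteq> topspace X \<and> X interior_of (X closure_of A) = {}"

definition meager_in :: "'a topology \<Rightarrow> 'a set \<Rightarrow> bool" where
  "meager_in X M \<longleftrightarrow>
     (\<exists>N :: nat \<Rightarrow> 'a set. (\<forall>n. nowhere_dense_in X (N n)) \<and> M = (\<Union>n. N n))"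

definition separately_continuous_map ::
    "'x topology \<Rightarrow> 'y topology \<Rightarrow> 'z topology \<Rightarrow> ('x \<times> 'y \<Rightarrow> 'z) \<Rightarrow> bool" where
  "separately_continuous_map X Y Z f \<longleftrightarrow>
     (\<forall>x \<in> topspace X. continuous_map Y Z (\<lambda>y. f (x, y))) \<and>
     (\<forall>y \<in> topspace Y. continuous_map X Z (\<lambda>x. f (x, y)))"

definition discontinuity_points :: "'a topology \<Rightarrow> 'b topology \<Rightarrow> ('a \<Rightarrow> 'b) \<Rightarrow> 'a set" where
  "discontinuity_points X Y f = {p \<in> topspace X. \<not> topcontinuous_at X Y f p}"

(* A definition cannot quantify over types, so the carrier types of X and Y are
   explicit parameters. They are to be left as type variables, so that a theorem
   concluding CC_Maslyuchenko ranges over all separable metrizable X and Y. *)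
definition CC_Maslyuchenko :: "'x itself \<Rightarrow> 'y itself \<Rightarrow> 'z topology \<Rightarrow> bool" where
  "CC_Maslyuchenko _ _ Z \<longleftrightarrow>
     (\<forall>(X :: 'x topology) (Y :: 'y topology) f.
        separable_space X \<and> metrizable_space X \<and>
        separable_space Y \<and> metrizable_space Y \<and>
        separately_continuous_map X Y Z f \<longrightarrow>
        meager_in X (fst ` discontinuity_points (prod_topology X Y) Z f) \<and>
        meager_in Y (snd ` discontinuity_points (prod_topology X Y) Z f))"

end

theory Submission
  imports Defs
begin

text \<open>
  Let \<open>f : X \<times> Y \<rightarrow> Z\<close> be separately continuous with \<open>X\<close>, \<open>Y\<close> separable metrizable.
  Approximating first the second and then the first coordinate by points of countable dense sets,
  one reaches every value of \<open>f\<close> from a countable set of values by two sequential closures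
  (\<open>separately_continuous_range\<close>). If \<open>Z\<close> is \<open>\<aleph>\<^sub>0\<close>-monolithic, then \<open>f\<close> therefore takes its
  values in an \<open>\<aleph>\<^sub>0\<close>-subspace, and \<open>Z\<close> may be replaced by a regular space with a countable
  \<open>k\<close>-network \<open>\<N>\<close>.

  In that situation (\<open>joint_continuity_off_meager_set\<close>), for a basic open \<open>V \<subseteq> Y\<close> and a finite
  \<open>\<F> \<subseteq> \<N>\<close> the set of all \<open>x\<close> such that \<open>f\<close> maps \<open>{x} \<times> V\<close> into the closure of \<open>\<Union>\<F>\<close> is closed,
  so its frontier is nowhere dense. There are countably many such frontiers. Let \<open>x\<close> lie on none
  of them, and let \<open>W\<close> be a neighbourhood of \<open>f (x, y)\<close>. By regularity \<open>W\<close> contains a closed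
  neighbourhood, and the continuous map \<open>f (x, -)\<close> sends some basic open \<open>V\<close> around \<open>y\<close> into \<open>\<Union>\<F>\<close>
  for some finite \<open>\<F>\<close> with \<open>\<Union>\<F>\<close> inside that closed neighbourhood
  (\<open>k_network_absorbs_neighbourhood\<close>). Since \<open>x\<close> is not a frontier point, \<open>f\<close> maps \<open>U \<times> V\<close> into the
  closure of \<open>\<Union>\<F>\<close>, hence into \<open>W\<close>, for some neighbourhood \<open>U\<close> of \<open>x\<close>; so \<open>f\<close> is continuous at
  \<open>(x, y)\<close> for every \<open>y\<close>. The projection to \<open>Y\<close> is handled by exchanging the two factors.

  The other two classes reduce to the monolithic one. Locally finite families are compact-finite,
  so \<open>\<aleph>\<close>-spaces are \<open>k\<^sup>*\<close>-metrizable. Let \<open>\<N>\<close> be a \<open>\<sigma>\<close>-compact-finite \<open>k\<close>-network. A subspace is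
  an \<open>\<aleph>\<^sub>0\<close>-space as soon as it meets only countably many members of \<open>\<N>\<close>, and this holds for
  every subspace with a countable network (\<open>countable_meeting_network\<close>): otherwise a convergent
  sequence would meet infinitely many members of one compact-finite family. Finally, if \<open>A\<close> meets
  only countably many members of \<open>\<N>\<close>, then their closures are a countable network for the
  sequential closure of \<open>A\<close> (\<open>network_for_sequential_closure\<close>), which is thus again an
  \<open>\<aleph>\<^sub>0\<close>-space.
\<close>

section \<open>Networks and convergent sequences\<close>

text \<open>
  The members of \<open>\<P>\<close> need not lie in \<open>B\<close>; this way a family of closures in the whole space can
  be a network for a subset.
\<close>

definition network_for :: "'a topology \<Rightarrow> 'a set \<Rightarrow> 'a set set \<Rightarrow> bool" where
  "network_for Z B \<P> \<longleftrightarrow>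
     (\<forall>z\<in>B. \<forall>W. openin Z W \<and> z \<in> W \<longrightarrow> (\<exists>P\<in>\<P>. z \<in> P \<and> P \<inter> B \<subseteq> W))"

text \<open>
  A convergent sequence with its limit is compact, so finitely many members of a \<open>k\<close>-network cover
  it, and one of them is visited infinitely often.
\<close>

lemma k_network_sequence:
  fixes s :: "nat \<Rightarrow> 'a"
  assumes N: "k_network Z \<N>" and lim: "limitin Z s l sequentially"
    and W: "openin Z W" "l \<in> W"
  obtains N where "N \<in> \<N>" "N \<subseteq> W" "infinite {n. s n \<in> N}"
proof -
  obtain m where m: "\<And>n. n \<ge> m \<Longrightarrow> s n \<in> W"
    using lim W unfolding limitin_sequentially by metis
  have sub: "s ` {m..} \<subseteq> topspace Z"
    using m openin_subset[OF W(1)] by auto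
  have "compactin Z (insert l (s ` {m..}))"
    by (rule compactin_sequence_with_limit[OF lim _ sub]) auto
  moreover have "insert l (s ` {m..}) \<subseteq> Z interior_of W"
    using m W by (auto simp: interior_of_openin)
  ultimately obtain \<F> where \<F>: "finite \<F>" "\<F> \<subseteq> \<N>" "insert l (s ` {m..}) \<subseteq> \<Union>\<F>" "\<Union>\<F> \<subseteq> W"
    using N openin_subset[OF W(1)] unfolding k_network_def by metis
  have "\<exists>N\<in>\<F>. infinite {n. s n \<in> N}"
  proof (rule ccontr)
    assume "\<not> ?thesis"
    then have "finite (\<Union>N\<in>\<F>. {n. s n \<in> N})"
      using \<F>(1) by auto
    moreover have "{m..} \<subseteq> (\<Union>N\<in>\<F>. {n. s n \<in> N})"
      using \<F>(3) by auto
    ultimately show False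
      using finite_subset infinite_Ici by blast
  qed
  then show thesis
    using that \<F> by blast
qed

lemma k_network_subtopology_imp_network_for:
  assumes N: "k_network (subtopology Z B) \<N>" and B: "B \<subseteq> topspace Z"
  shows "network_for Z B \<N>"
  unfolding network_for_def
proof (intro ballI allI impI)
  fix z W assume z: "z \<in> B" and W: "openin Z W \<and> z \<in> W"
  have "limitin (subtopology Z B) (\<lambda>n::nat. z) z sequentially"
    using z B by (auto simp: limitin_sequentially)
  moreover have "openin (subtopology Z B) (B \<inter> W)"
    using W openin_subtopology_Int2 by blast
  moreover have "z \<in> B \<inter> W"
    using z W by blast
  ultimately obtain N where "N \<in> \<N>" "N \<subseteq> B \<inter> W" "infinite {n::nat. z \<in> N}"
    by (rule k_network_sequence[OF N])
  then show "\<exists>P\<in>\<N>. z \<in> P \<and> P \<inter> B \<subseteq> W"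
    by (metis empty_Collect_eq finite.emptyI inf.coboundedI1 le_inf_iff)
qed

section \<open>Compact-finite families and subspaces with a countable network\<close>

text \<open>
  A set with a countable network carries a finer second countable topology, generated by the network,
  in which all but countably many points of an uncountable subset are limits of nontrivial
  sequences in that subset. The proof works directly with an enumeration of the network: \<open>E m z\<close> plays
  the role of the \<open>m\<close>-th basic neighbourhood of \<open>z\<close> in the finer topology.
\<close>

lemma uncountable_imp_nontrivial_sequence:
  assumes P: "network_for Z B \<P>" "countable \<P>" and B: "B \<subseteq> topspace Z"
    and S: "S \<subseteq> B" "uncountable S"
  obtains z and s :: "nat \<Rightarrow> 'a" where "z \<in> S" "range s \<subseteq> S - {z}" "limitin Z s z sequentially"
proof -
  have "\<P> \<noteq> {}"
    using P(1) S B unfolding network_for_def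
    by (metis countable_empty equals0D openin_topspace subsetD subsetI subset_empty)
  then obtain p :: "nat \<Rightarrow> 'a set" where p: "\<P> = range p"
    using P(2) uncountable_def by metis
  define E where "E = (\<lambda>m z. {z' \<in> S. \<forall>i<m. z \<in> p i \<longrightarrow> z' \<in> p i})"
  have "\<exists>z\<in>S. \<forall>m. \<not> E m z \<subseteq> {z}"
  proof (rule ccontr)
    assume "\<not> ?thesis"
    then have "\<forall>z\<in>S. \<exists>m. E m z \<subseteq> {z}"
      by blast
    from bchoice[OF this] obtain m where m: "\<forall>z\<in>S. E (m z) z \<subseteq> {z}" ..
    \<comment> \<open>An isolated point is determined by the index of a neighbourhood isolating it together with
        the finitely many network members that define this neighbourhood.\<close>
    have "inj_on (\<lambda>z. (m z, {i. i < m z \<and> z \<in> p i})) S"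
    proof (rule inj_onI)
      fix z z' assume z: "z \<in> S" "z' \<in> S"
        and eq: "(m z, {i. i < m z \<and> z \<in> p i}) = (m z', {i. i < m z' \<and> z' \<in> p i})"
      have "{i. i < m z \<and> z \<in> p i} = {i. i < m z' \<and> z' \<in> p i}"
        using eq by (rule Pair_inject)
      then have "i < m z \<Longrightarrow> z \<in> p i \<Longrightarrow> z' \<in> p i" for i
        by blast
      then have "z' \<in> E (m z) z"
        unfolding E_def using z(2) by simp
      then show "z = z'"
        using m z(1) by blast
    qed
    moreover have "(\<lambda>z. (m z, {i. i < m z \<and> z \<in> p i})) ` S \<subseteq> UNIV \<times> {F. finite F}"
      by auto
    moreover have "countable ((UNIV :: nat set) \<times> {F :: nat set. finite F})"
      by (intro countable_SIGMA countable_Collect_finite) auto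
    ultimately have "countable S"
      using countable_subset countable_image_inj_on by blast
    then show False
      using S by blast
  qed
  then obtain z where z: "z \<in> S" "\<And>m. \<not> E m z \<subseteq> {z}"
    by blast
  then have "\<forall>m. \<exists>z'. z' \<in> E m z \<and> z' \<noteq> z"
    by blast
  then obtain s where s: "\<And>m. s m \<in> E m z" "\<And>m. s m \<noteq> z"
    by metis
  have "limitin Z s z sequentially"
    unfolding limitin_sequentially
  proof (intro conjI allI impI)
    show "z \<in> topspace Z"
      using z S B by auto
    fix W assume "openin Z W \<and> z \<in> W"
    then obtain i where i: "z \<in> p i" "p i \<inter> B \<subseteq> W"
      using P(1) z(1) S(1) unfolding network_for_def p by blast
    have "s n \<in> W" if "n \<ge> Suc i" for n
      using s(1)[of n] that i S(1) unfolding E_def by auto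
    then show "\<exists>N. \<forall>n\<ge>N. s n \<in> W"
      by blast
  qed
  then show thesis
    using that z(1) s unfolding E_def by blast
qed

lemma infinite_range_of_nontrivial_sequence:
  fixes s :: "nat \<Rightarrow> 'a"
  assumes Z: "t1_space Z" and s: "limitin Z s z sequentially" and ne: "z \<notin> range s"
  shows "infinite (range s)"
proof
  assume "finite (range s)"
  then have "closedin Z (topspace Z \<inter> range s)"
    using Z by (simp add: t1_space_closedin_finite)
  then have "openin Z (topspace Z - topspace Z \<inter> range s)"
    by blast
  moreover have "z \<in> topspace Z - topspace Z \<inter> range s"
    using limitin_topspace[OF s] ne by blast
  ultimately show False
    using s unfolding limitin_sequentially by blast
qed

text \<open>
  If uncountably many members met \<open>B\<close>, then, \<open>\<A>\<close> being point-finite, uncountably many points of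
  \<open>B\<close> would be needed to represent them, and a nontrivial convergent sequence of such points would,
  together with its limit, be a compact set meeting infinitely many members.
\<close>

lemma countable_meeting_network:
  assumes Z: "t1_space Z" and A: "compact_finite_in Z \<A>"
    and P: "network_for Z B \<P>" "countable \<P>" and B: "B \<subseteq> topspace Z"
  shows "countable {A \<in> \<A>. A \<inter> B \<noteq> {}}"
proof -
  define \<B> where "\<B> = {A \<in> \<A>. A \<inter> B \<noteq> {}}"
  have "\<forall>A\<in>\<B>. \<exists>z. z \<in> A \<inter> B"
    unfolding \<B>_def by blast
  from bchoice[OF this] obtain g where g: "\<forall>A\<in>\<B>. g A \<in> A \<inter> B" ..
  have fin: "finite {A \<in> \<A>. A \<inter> K \<noteq> {}}" if "compactin Z K" for K
    using A that unfolding compact_finite_in_def by simp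
  have gB: "g ` \<B> \<subseteq> B"
    using g by auto
  have "countable (g ` \<B>)"
  proof (rule ccontr)
    assume "uncountable (g ` \<B>)"
    then obtain z and s :: "nat \<Rightarrow> 'a" where s: "range s \<subseteq> g ` \<B> - {z}" "limitin Z s z sequentially"
      using uncountable_imp_nontrivial_sequence[OF P B gB] by metis
    have "compactin Z (insert z (range s))"
      using s gB B by (intro compactin_sequence_with_limit[OF s(2)]) auto
    then have "finite (g ` {A \<in> \<A>. A \<inter> insert z (range s) \<noteq> {}})"
      using fin by blast
    moreover have "range s \<subseteq> g ` {A \<in> \<A>. A \<inter> insert z (range s) \<noteq> {}}"
    proof
      fix y assume y: "y \<in> range s"
      then obtain A where "A \<in> \<B>" "y = g A"
        using s(1) by blast
      then show "y \<in> g ` {A \<in> \<A>. A \<inter> insert z (range s) \<noteq> {}}"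
        using g y unfolding \<B>_def by blast
    qed
    ultimately have "finite (range s)"
      by (rule rev_finite_subset)
    moreover have "z \<notin> range s"
      using s(1) by blast
    ultimately show False
      using infinite_range_of_nontrivial_sequence[OF Z s(2)] by blast
  qed
  moreover have "countable {A \<in> \<A>. A \<inter> {y} \<noteq> {}}" if "y \<in> g ` \<B>" for y
    using fin[of "{y}"] that gB B by (intro countable_finite) auto
  ultimately have "countable (\<Union>y\<in>g ` \<B>. {A \<in> \<A>. A \<inter> {y} \<noteq> {}})"
    by (rule countable_UN)
  moreover have "\<B> \<subseteq> (\<Union>y\<in>g ` \<B>. {A \<in> \<A>. A \<inter> {y} \<noteq> {}})"
    using g unfolding \<B>_def by blast
  ultimately show ?thesis
    unfolding \<B>_def by (rule countable_subset[rotated])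
qed

lemma countable_meeting_sigma_compact_finite:
  assumes Z: "t1_space Z" and N: "sigma_compact_finite_in Z \<N>"
    and P: "network_for Z B \<P>" "countable \<P>" and B: "B \<subseteq> topspace Z"
  shows "countable {N \<in> \<N>. N \<inter> B \<noteq> {}}"
proof -
  obtain \<F> :: "nat \<Rightarrow> 'a set set" where \<F>: "\<And>n. compact_finite_in Z (\<F> n)" "\<N> = (\<Union>n. \<F> n)"
    using N unfolding sigma_compact_finite_in_def by blast
  have "{N \<in> \<N>. N \<inter> B \<noteq> {}} = (\<Union>n. {N \<in> \<F> n. N \<inter> B \<noteq> {}})"
    using \<F>(2) by blast
  then show ?thesis
    using countable_meeting_network[OF Z \<F>(1) P B] by auto
qed

section \<open>Monolithicity of k*-metrizable spaces\<close>

text \<open>The traces on a subset of the members of a \<open>k\<close>-network form a \<open>k\<close>-network of the subspace.\<close>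

lemma aleph0_space_subtopology:
  assumes Z: "regular_Hausdorff_space Z" and N: "k_network Z \<N>"
    and A: "A \<subseteq> topspace Z" "countable {N \<in> \<N>. N \<inter> A \<noteq> {}}"
  shows "aleph0_space (subtopology Z A)"
proof -
  let ?\<T> = "(\<lambda>N. N \<inter> A) ` {N \<in> \<N>. N \<inter> A \<noteq> {}}"
  have "k_network (subtopology Z A) ?\<T>"
    unfolding k_network_def
  proof (intro conjI allI impI)
    show "\<Union>?\<T> \<subseteq> topspace (subtopology Z A)"
      using A by auto
    fix K U
    assume KU: "compactin (subtopology Z A) K \<and> U \<subseteq> topspace (subtopology Z A) \<and>
      K \<subseteq> subtopology Z A interior_of U"
    then have K: "compactin Z K" "K \<subseteq> A"
      by (auto simp: compactin_subtopology)
    obtain G where G: "openin Z G" "subtopology Z A interior_of U = G \<inter> A"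
      using openin_interior_of[of "subtopology Z A" U] unfolding openin_subtopology by auto
    have "G \<inter> A \<subseteq> U"
      using G(2) interior_of_subset by metis
    have "K \<subseteq> Z interior_of G"
      using KU G by (auto simp: interior_of_openin)
    then obtain \<F> where \<F>: "finite \<F>" "\<F> \<subseteq> \<N>" "K \<subseteq> \<Union>\<F>" "\<Union>\<F> \<subseteq> G"
      using N K(1) openin_subset[OF G(1)] unfolding k_network_def by metis
    let ?\<G> = "(\<lambda>N. N \<inter> A) ` {N \<in> \<F>. N \<inter> A \<noteq> {}}"
    have "finite ?\<G>" "?\<G> \<subseteq> ?\<T>" "\<Union>?\<G> \<subseteq> U"
      using \<F> \<open>G \<inter> A \<subseteq> U\<close> by auto
    moreover have "K \<subseteq> \<Union>?\<G>"
      using \<F>(3) K(2) by blast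
    ultimately show "\<exists>\<F>. finite \<F> \<and> \<F> \<subseteq> ?\<T> \<and> K \<subseteq> \<Union>\<F> \<and> \<Union>\<F> \<subseteq> U"
      by blast
  qed
  moreover have "countable ?\<T>"
    using A(2) by (rule countable_image)
  ultimately show ?thesis
    using Z unfolding aleph0_space_def regular_Hausdorff_space_def
    by (metis regular_space_subtopology Hausdorff_space_subtopology)
qed

lemma sequential_closure_of_subset_topspace: "sequential_closure_of Z A \<subseteq> topspace Z"
  unfolding sequential_closure_of_def using limitin_topspace by fastforce

text \<open>
  If a sequence in \<open>A\<close> converges to \<open>z\<close>, then a member of the \<open>k\<close>-network visited infinitely often
  meets \<open>A\<close> and has \<open>z\<close> in its closure; regularity keeps this closure near \<open>z\<close>.
\<close>

lemma network_for_sequential_closure: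
  assumes Z: "regular_space Z" and N: "k_network Z \<N>"
  shows "network_for Z (sequential_closure_of Z A)
    ((\<lambda>N. Z closure_of N) ` {N \<in> \<N>. N \<inter> A \<noteq> {}})"
  unfolding network_for_def
proof (intro ballI allI impI)
  fix z W assume "z \<in> sequential_closure_of Z A" and W: "openin Z W \<and> z \<in> W"
  then obtain a :: "nat \<Rightarrow> 'a" where a: "range a \<subseteq> A" "limitin Z a z sequentially"
    unfolding sequential_closure_of_def by blast
  obtain U C where U: "openin Z U" "closedin Z C" "z \<in> U" "U \<subseteq> C" "C \<subseteq> W"
    using Z W by (metis neighbourhood_base_of neighbourhood_base_of_closedin)
  obtain N where n: "N \<in> \<N>" "N \<subseteq> U" "infinite {n. a n \<in> N}"
    using k_network_sequence[OF N a(2) U(1,3)] .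
  have "N \<inter> A \<noteq> {}"
    using n(3) a(1) not_finite_existsD by fastforce
  moreover have "z \<in> Z closure_of N"
    unfolding in_closure_of
  proof (intro conjI allI impI)
    show "z \<in> topspace Z"
      using a(2) limitin_topspace by fast
    fix G assume "z \<in> G \<and> openin Z G"
    then obtain m where "\<And>n. n \<ge> m \<Longrightarrow> a n \<in> G"
      using a(2) unfolding limitin_sequentially by metis
    moreover obtain k where "k \<ge> m" "a k \<in> N"
      using n(3) unfolding infinite_nat_iff_unbounded_le by auto
    ultimately show "\<exists>y. y \<in> N \<and> y \<in> G"
      by blast
  qed
  moreover have "Z closure_of N \<subseteq> C"
    using n(2) U(2,4) by (intro closure_of_minimal) auto
  ultimately show "\<exists>P\<in>(\<lambda>N. Z closure_of N) ` {N \<in> \<N>. N \<inter> A \<noteq> {}}.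
      z \<in> P \<and> P \<inter> sequential_closure_of Z A \<subseteq> W"
    using n(1) U(5) by blast
qed

lemma k_star_metrizable_imp_aleph0_monolithic:
  assumes "k_star_metrizable_space Z"
  shows "aleph0_monolithic_space Z"
proof -
  obtain \<N> where Z: "regular_Hausdorff_space Z" and N: "k_network Z \<N>"
    and sigma: "sigma_compact_finite_in Z \<N>"
    using assms unfolding k_star_metrizable_space_def by blast
  have reg: "regular_space Z" and t1: "t1_space Z"
    using Z unfolding regular_Hausdorff_space_def by (auto simp: Hausdorff_imp_t1_space)
  have sub: "aleph0_space (subtopology Z A)"
    if "A \<subseteq> topspace Z" "network_for Z A \<P>" "countable \<P>" for A \<P>
    using aleph0_space_subtopology[OF Z N that(1)]
      countable_meeting_sigma_compact_finite[OF t1 sigma that(2,3,1)] by blast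
  have "aleph0_space (subtopology Z A)" if "A \<subseteq> topspace Z" "countable A" for A
  proof (rule sub)
    show "network_for Z A ((\<lambda>z. {z}) ` A)"
      unfolding network_for_def by blast
  qed (use that in auto)
  moreover have "aleph0_space (subtopology Z (sequential_closure_of Z A))"
    if A: "A \<subseteq> topspace Z" "aleph0_space (subtopology Z A)" for A
  proof -
    obtain \<M> where M: "k_network (subtopology Z A) \<M>" "countable \<M>"
      using A(2) unfolding aleph0_space_def by blast
    have "countable {N \<in> \<N>. N \<inter> A \<noteq> {}}"
      using countable_meeting_sigma_compact_finite[OF t1 sigma _ M(2) A(1)]
        k_network_subtopology_imp_network_for[OF M(1) A(1)] by blast
    then show ?thesis
      using sub[OF sequential_closure_of_subset_topspace network_for_sequential_closure[OF reg N]]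
      by blast
  qed
  ultimately show ?thesis
    using Z unfolding aleph0_monolithic_space_def by simp
qed

lemma locally_finite_imp_compact_finite:
  assumes "locally_finite_in Z \<A>"
  shows "compact_finite_in Z \<A>"
  unfolding compact_finite_in_def
proof (intro conjI allI impI)
  show "\<Union>\<A> \<subseteq> topspace Z"
    using assms unfolding locally_finite_in_def by blast
  fix K assume K: "compactin Z K"
  define \<V> where "\<V> = {V. openin Z V \<and> finite {A \<in> \<A>. A \<inter> V \<noteq> {}}}"
  have "K \<subseteq> \<Union>\<V>"
    using assms compactin_subset_topspace[OF K] unfolding locally_finite_in_def \<V>_def by blast
  then obtain \<F> where \<F>: "finite \<F>" "\<F> \<subseteq> \<V>" "K \<subseteq> \<Union>\<F>"
    using compactinD[OF K, of \<V>] unfolding \<V>_def by blast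
  then have "finite (\<Union>V\<in>\<F>. {A \<in> \<A>. A \<inter> V \<noteq> {}})"
    unfolding \<V>_def by blast
  moreover have "{A \<in> \<A>. A \<inter> K \<noteq> {}} \<subseteq> (\<Union>V\<in>\<F>. {A \<in> \<A>. A \<inter> V \<noteq> {}})"
    using \<F>(3) by blast
  ultimately show "finite {A \<in> \<A>. A \<inter> K \<noteq> {}}"
    by (rule rev_finite_subset)
qed

lemma aleph_imp_k_star_metrizable:
  assumes "aleph_space Z"
  shows "k_star_metrizable_space Z"
  using assms locally_finite_imp_compact_finite
  unfolding aleph_space_def k_star_metrizable_space_def
    sigma_locally_finite_in_def sigma_compact_finite_in_def by metis

section \<open>Separable metrizable spaces\<close>

lemma separable_metrizable_imp_second_countable:
  assumes "separable_space X" "metrizable_space X"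
  shows "second_countable X"
proof -
  obtain M d where "Metric_space M d" and X: "X = Metric_space.mtopology M d"
    using assms(2) unfolding metrizable_space_def by blast
  then interpret Metric_space M d by blast
  obtain C where C: "countable C" "C \<subseteq> M" "mtopology closure_of C = M"
    using assms(1) unfolding separable_space_def X by auto
  define \<B> where "\<B> = (\<lambda>(c, n::nat). mball c (inverse (Suc n))) ` (C \<times> UNIV)"
  have "\<exists>V\<in>\<B>. x \<in> V \<and> V \<subseteq> U" if U: "openin mtopology U" "x \<in> U" for U x
  proof -
    obtain r where r: "r > 0" "mball x r \<subseteq> U" and x: "x \<in> M"
      using U openin_mtopology by (metis subsetD)
    \<comment> \<open>A ball of radius below \<open>r / 2\<close> that contains \<open>x\<close> lies in the \<open>r\<close>-ball around \<open>x\<close>.\<close>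
    obtain n where n: "inverse (Suc n) < r / 2"
      using reals_Archimedean[of "r / 2"] r(1) by auto
    have "x \<in> {x \<in> M. \<forall>\<rho>>0. \<exists>c\<in>C. c \<in> mball x \<rho>}"
      using C(3) x unfolding metric_closure_of by simp
    moreover have "inverse (real (Suc n)) > 0"
      by simp
    ultimately obtain c where c: "c \<in> C" "c \<in> mball x (inverse (Suc n))"
      by blast
    have "mball c (inverse (Suc n)) \<subseteq> mball x r"
    proof
      fix y assume "y \<in> mball c (inverse (Suc n))"
      then have y: "y \<in> M" "d c y < inverse (Suc n)"
        by auto
      have "c \<in> M" "d x c < inverse (Suc n)"
        using c by auto
      then have "d x y < r"
        using triangle[of x c y] x y n by linarith
      then show "y \<in> mball x r"
        using x y by simp
    qed
    moreover have "x \<in> mball c (inverse (Suc n))"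
      using c x by (auto simp: commute)
    moreover have "mball c (inverse (Suc n)) \<in> \<B>"
      using c(1) unfolding \<B>_def by force
    ultimately show ?thesis
      using r(2) by blast
  qed
  moreover have "countable \<B>" "\<forall>V\<in>\<B>. openin mtopology V"
    using C(1) unfolding \<B>_def by auto
  ultimately show ?thesis
    unfolding second_countable_def X by blast
qed

lemma dense_sequence:
  assumes "metrizable_space X" "X closure_of C = topspace X" "x \<in> topspace X"
  obtains s :: "nat \<Rightarrow> 'a" where "range s \<subseteq> C" "limitin X s x sequentially"
proof -
  obtain M d where "Metric_space M d" and X: "X = Metric_space.mtopology M d"
    using assms(1) unfolding metrizable_space_def by blast
  then interpret Metric_space M d by blast
  have "x \<in> mtopology closure_of C"
    using assms(2,3) unfolding X by simp
  then show thesis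
    using that unfolding closure_of_sequentially X by blast
qed

text \<open>
  With dense countable sets \<open>C\<close> and \<open>D\<close>, the values on \<open>C \<times> Y\<close> are limits of values on
  \<open>C \<times> D\<close>, and all values are limits of values on \<open>C \<times> Y\<close>.
\<close>

lemma separately_continuous_range:
  assumes X: "separable_space X" "metrizable_space X"
    and Y: "separable_space Y" "metrizable_space Y"
    and f: "separately_continuous_map X Y Z f"
  obtains A where "countable A" "A \<subseteq> topspace Z"
    "f ` (topspace X \<times> topspace Y) \<subseteq> sequential_closure_of Z (sequential_closure_of Z A)"
proof -
  obtain C where C: "countable C" "C \<subseteq> topspace X" "X closure_of C = topspace X"
    using X(1) unfolding separable_space_def by blast
  obtain D where D: "countable D" "D \<subseteq> topspace Y" "Y closure_of D = topspace Y"
    using Y(1) unfolding separable_space_def by blast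
  have f1: "continuous_map Y Z (\<lambda>y. f (x, y))" if "x \<in> topspace X" for x
    using f that unfolding separately_continuous_map_def by blast
  have f2: "continuous_map X Z (\<lambda>x. f (x, y))" if "y \<in> topspace Y" for y
    using f that unfolding separately_continuous_map_def by blast
  have first: "f (x, y) \<in> sequential_closure_of Z (f ` (C \<times> D))"
    if x: "x \<in> C" and y: "y \<in> topspace Y" for x y
  proof -
    obtain s :: "nat \<Rightarrow> 'b" where s: "range s \<subseteq> D" "limitin Y s y sequentially"
      using dense_sequence[OF Y(2) D(3) y] .
    have "limitin Z ((\<lambda>y. f (x, y)) \<circ> s) (f (x, y)) sequentially"
      using continuous_map_limit[OF f1 s(2)] x C(2) by blast
    moreover have "range ((\<lambda>y. f (x, y)) \<circ> s) \<subseteq> f ` (C \<times> D)"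
      using s(1) x by auto
    ultimately show ?thesis
      unfolding sequential_closure_of_def by blast
  qed
  have second: "f (x, y) \<in> sequential_closure_of Z (sequential_closure_of Z (f ` (C \<times> D)))"
    if x: "x \<in> topspace X" and y: "y \<in> topspace Y" for x y
  proof -
    obtain s :: "nat \<Rightarrow> 'a" where s: "range s \<subseteq> C" "limitin X s x sequentially"
      using dense_sequence[OF X(2) C(3) x] .
    have "limitin Z ((\<lambda>x. f (x, y)) \<circ> s) (f (x, y)) sequentially"
      using continuous_map_limit[OF f2 s(2)] y by blast
    moreover have "range ((\<lambda>x. f (x, y)) \<circ> s) \<subseteq> sequential_closure_of Z (f ` (C \<times> D))"
      using s(1) first y by auto
    ultimately show ?thesis
      unfolding sequential_closure_of_def[of Z "sequential_closure_of Z _"] by blast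
  qed
  show thesis
  proof
    show "countable (f ` (C \<times> D))"
      using C(1) D(1) by blast
    have "f (x, y) \<in> topspace Z" if "x \<in> topspace X" "y \<in> topspace Y" for x y
      using f1[OF that(1)] that(2) by (auto simp: continuous_map_def Pi_iff)
    then show "f ` (C \<times> D) \<subseteq> topspace Z"
      using C(2) D(2) by auto
  qed (use second in auto)
qed

section \<open>Joint continuity off a meager set\<close>

lemma meager_in_subset_countable_Union:
  assumes "countable \<C>" "\<And>C. C \<in> \<C> \<Longrightarrow> nowhere_dense_in X C" "M \<subseteq> \<Union>\<C>"
  shows "meager_in X M"
proof -
  \<comment> \<open>The empty set is added so that the family can be enumerated even if it is empty.\<close>
  define c where "c = from_nat_into (insert {} \<C>)"
  have c: "range c = insert {} \<C>"
    unfolding c_def using assms(1) by (intro range_from_nat_into) auto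
  have "nowhere_dense_in X (M \<inter> c n)" for n
  proof -
    have "nowhere_dense_in X (c n)"
      using c assms(2) rangeI[of c n] by (auto simp: nowhere_dense_in_def)
    then show ?thesis
      unfolding nowhere_dense_in_def
      by (metis Int_lower2 closure_of_mono interior_of_mono subset_empty subset_trans)
  qed
  moreover have "M = (\<Union>n. M \<inter> c n)"
    using assms(3) c by blast
  ultimately show ?thesis
    unfolding meager_in_def by (intro exI[of _ "\<lambda>n. M \<inter> c n"]) blast
qed

lemma meager_in_subset:
  assumes "meager_in X M" "M' \<subseteq> M"
  shows "meager_in X M'"
proof -
  obtain N :: "nat \<Rightarrow> 'a set" where "\<And>n. nowhere_dense_in X (N n)" "M = (\<Union>n. N n)"
    using assms(1) unfolding meager_in_def by blast
  then show ?thesis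
    using assms(2) by (intro meager_in_subset_countable_Union[of "range N"]) auto
qed

lemma nowhere_dense_in_frontier_of_closedin:
  assumes "closedin X S"
  shows "nowhere_dense_in X (X frontier_of S)"
proof -
  have "X interior_of (X frontier_of S) \<subseteq> X interior_of S"
    using assms by (intro interior_of_mono frontier_of_subset_closedin)
  moreover have "X interior_of (X frontier_of S) \<subseteq> X frontier_of S"
    by (rule interior_of_subset)
  moreover have "X frontier_of S \<inter> X interior_of S = {}"
    unfolding frontier_of_def by blast
  ultimately have "X interior_of (X frontier_of S) = {}"
    by blast
  then show ?thesis
    unfolding nowhere_dense_in_def
    by (simp add: closure_of_closedin closedin_frontier_of frontier_of_subset_topspace)
qed

text \<open>
  The \<open>k\<close>-network property upgrades from compact sets to neighbourhoods because \<open>Y\<close> is first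
  countable: if no finite union of members contained in \<open>W\<close> absorbed a neighbourhood of \<open>y\<close>, then
  one could choose points \<open>s n\<close> converging to \<open>y\<close> with \<open>g (s n)\<close> outside the first \<open>n\<close> members,
  whereas some member contains \<open>g (s n)\<close> for infinitely many \<open>n\<close>.
\<close>

lemma k_network_absorbs_neighbourhood:
  assumes N: "k_network Z \<N>" "countable \<N>" and Y: "first_countable Y"
    and g: "continuous_map Y Z g" and y: "y \<in> topspace Y"
    and W: "openin Z W" "g y \<in> W"
  obtains V \<F> where "openin Y V" "y \<in> V" "finite \<F>" "\<F> \<subseteq> \<N>" "\<Union>\<F> \<subseteq> W" "g ` V \<subseteq> \<Union>\<F>"
proof -
  obtain \<B> where \<B>: "countable \<B>" "\<And>V. V \<in> \<B> \<Longrightarrow> openin Y V"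
    "\<And>U. openin Y U \<Longrightarrow> y \<in> U \<Longrightarrow> \<exists>V\<in>\<B>. y \<in> V \<and> V \<subseteq> U"
    using Y y unfolding first_countable_def by metis
  define b where "b = from_nat_into {V \<in> \<B>. y \<in> V}"
  have b: "range b = {V \<in> \<B>. y \<in> V}"
    unfolding b_def
  proof (rule range_from_nat_into)
    show "{V \<in> \<B>. y \<in> V} \<noteq> {}"
      using \<B>(3)[of "topspace Y"] y by blast
    show "countable {V \<in> \<B>. y \<in> V}"
      using \<B>(1) by (rule countable_subset[rotated]) auto
  qed
  define V where "V = (\<lambda>n::nat. \<Inter>i\<in>{..n}. b i)"
  have b': "openin Y (b i)" "y \<in> b i" for i
    using \<B>(2) b rangeI[of b i] by auto
  have V: "openin Y (V n)" "y \<in> V n" for n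
    using b' unfolding V_def by (auto intro!: openin_Inter)
  obtain N0 where N0: "N0 \<in> {N \<in> \<N>. N \<subseteq> W}"
    using k_network_sequence[OF N(1), of "\<lambda>n. g y" "g y" W] W
    by (metis (no_types, lifting) limitin_const_iff limitin_sequentially mem_Collect_eq openin_subset subsetD)
  define e where "e = from_nat_into {N \<in> \<N>. N \<subseteq> W}"
  have e: "range e = {N \<in> \<N>. N \<subseteq> W}"
    unfolding e_def using N0 N(2) by (intro range_from_nat_into) auto
  have "\<exists>n. g ` V n \<subseteq> \<Union>(e ` {..n})"
  proof (rule ccontr)
    assume "\<not> ?thesis"
    then have "\<forall>n. \<exists>v. v \<in> V n \<and> g v \<notin> \<Union>(e ` {..n})"
      by blast
    then obtain s where s: "\<And>n. s n \<in> V n" "\<And>n. g (s n) \<notin> \<Union>(e ` {..n})"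
      by metis
    have "limitin Y s y sequentially"
      unfolding limitin_sequentially
    proof (intro conjI allI impI)
      fix U assume "openin Y U \<and> y \<in> U"
      then obtain i where "b i \<subseteq> U"
        using \<B>(3) b by (metis (mono_tags, lifting) mem_Collect_eq rangeE)
      then have "\<forall>n\<ge>i. s n \<in> U"
        using s(1) unfolding V_def by blast
      then show "\<exists>m. \<forall>n\<ge>m. s n \<in> U" ..
    qed (rule y)
    then have "limitin Z (g \<circ> s) (g y) sequentially"
      using g by (metis continuous_map_limit)
    then obtain N where n: "N \<in> \<N>" "N \<subseteq> W" "infinite {n. (g \<circ> s) n \<in> N}"
      using k_network_sequence[OF N(1) _ W] by metis
    then obtain m where m: "N = e m"
      using e by blast
    obtain k where "k \<ge> m" "g (s k) \<in> N"
      using n(3) unfolding infinite_nat_iff_unbounded_le by auto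
    then show False
      using s(2)[of k] m by auto
  qed
  then obtain n where "g ` V n \<subseteq> \<Union>(e ` {..n})" ..
  moreover have "e ` {..n} \<subseteq> \<N>" "\<Union>(e ` {..n}) \<subseteq> W"
    using e by auto
  ultimately show thesis
    using that[of "V n" "e ` {..n}"] V by blast
qed

lemma joint_continuity_off_meager_set:
  assumes Z: "regular_space Z" and N: "k_network Z \<N>" "countable \<N>"
    and Y: "second_countable Y"
    and f1: "\<And>x. x \<in> topspace X \<Longrightarrow> continuous_map Y Z (f x)"
    and f2: "\<And>y. y \<in> topspace Y \<Longrightarrow> continuous_map X Z (\<lambda>x. f x y)"
  shows "meager_in X {x \<in> topspace X. \<exists>y\<in>topspace Y.
    \<not> topcontinuous_at (prod_topology X Y) Z (\<lambda>(x, y). f x y) (x, y)}"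
    (is "meager_in X ?M")
proof -
  obtain \<B> where \<B>: "countable \<B>" "\<And>V. V \<in> \<B> \<Longrightarrow> openin Y V"
    "\<And>U y. openin Y U \<Longrightarrow> y \<in> U \<Longrightarrow> \<exists>V\<in>\<B>. y \<in> V \<and> V \<subseteq> U"
    using Y unfolding second_countable_def by metis
  define S where "S = (\<lambda>V \<F>. {x \<in> topspace X. \<forall>v\<in>V. f x v \<in> Z closure_of (\<Union>\<F>)})"
  define \<I> where "\<I> = \<B> \<times> {\<F>. finite \<F> \<and> \<F> \<subseteq> \<N>}"
  have closed: "closedin X (S V \<F>)" if "V \<in> \<B>" for V \<F>
  proof -
    have "closedin X {x \<in> topspace X. f x v \<in> Z closure_of (\<Union>\<F>)}" if "v \<in> V" for v
      using that \<open>V \<in> \<B>\<close> \<B>(2) openin_subset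
      by (intro closedin_continuous_map_preimage[OF f2]) auto
    moreover have "S V \<F> = topspace X \<inter> (\<Inter>v\<in>V. {x \<in> topspace X. f x v \<in> Z closure_of (\<Union>\<F>)})"
      unfolding S_def by blast
    ultimately show ?thesis
      by (cases "V = {}") (auto intro!: closedin_Int closedin_INT)
  qed
  have "countable \<I>"
    unfolding \<I>_def using \<B>(1) countable_Collect_finite_subset[OF N(2)]
    by (intro countable_SIGMA) auto
  then have "countable ((\<lambda>(V, \<F>). X frontier_of S V \<F>) ` \<I>)"
    by (rule countable_image)
  moreover have "nowhere_dense_in X C" if "C \<in> (\<lambda>(V, \<F>). X frontier_of S V \<F>) ` \<I>" for C
    using that closed nowhere_dense_in_frontier_of_closedin unfolding \<I>_def by auto
  moreover have "?M \<subseteq> \<Union>((\<lambda>(V, \<F>). X frontier_of S V \<F>) ` \<I>)"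
  proof (rule subsetI, rule ccontr)
    fix x assume "x \<in> ?M"
      and out: "x \<notin> \<Union>((\<lambda>(V, \<F>). X frontier_of S V \<F>) ` \<I>)"
    then obtain y where x: "x \<in> topspace X" and y: "y \<in> topspace Y"
      and discont: "\<not> topcontinuous_at (prod_topology X Y) Z (\<lambda>(x, y). f x y) (x, y)"
      by blast
    have "(\<lambda>(x, y). f x y) \<in> topspace (prod_topology X Y) \<rightarrow> topspace Z"
      using f1 by (auto simp: continuous_map_def Pi_iff)
    then obtain W where W: "openin Z W" "f x y \<in> W"
      and not: "\<And>O'. openin (prod_topology X Y) O' \<Longrightarrow> (x, y) \<in> O' \<Longrightarrow> \<exists>p\<in>O'. (case p of (u, v) \<Rightarrow> f u v) \<notin> W"
      using discont x y unfolding topcontinuous_at_def by auto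
    have off: "x \<notin> X frontier_of S V \<F>" if "(V, \<F>) \<in> \<I>" for V \<F>
      using out that by auto
    obtain G C where G: "openin Z G" "closedin Z C" "f x y \<in> G" "G \<subseteq> C" "C \<subseteq> W"
      using Z W by (metis neighbourhood_base_of neighbourhood_base_of_closedin)
    obtain V' \<F> where V': "openin Y V'" "y \<in> V'" "finite \<F>" "\<F> \<subseteq> \<N>" "\<Union>\<F> \<subseteq> G" "f x ` V' \<subseteq> \<Union>\<F>"
      using k_network_absorbs_neighbourhood[OF N second_countable_imp_first_countable[OF Y] f1[OF x] y G(1,3)] .
    obtain V where V: "V \<in> \<B>" "y \<in> V" "V \<subseteq> V'"
      using \<B>(3)[OF V'(1,2)] by blast
    have "\<Union>\<F> \<subseteq> topspace Z"
      using V'(5) G(1) openin_subset by blast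
    then have "x \<in> S V \<F>"
      using x V(3) V'(6) closure_of_subset unfolding S_def by fastforce
    moreover have "x \<notin> X frontier_of S V \<F>"
      using off V(1) V'(3,4) unfolding \<I>_def by blast
    ultimately have "x \<in> X interior_of S V \<F>"
      using closure_of_closedin[OF closed[OF V(1)], of \<F>] unfolding frontier_of_def by blast
    moreover have "f u v \<in> W" if "u \<in> X interior_of S V \<F>" "v \<in> V" for u v
    proof -
      have "u \<in> S V \<F>"
        using that(1) interior_of_subset by fastforce
      then have "f u v \<in> Z closure_of (\<Union>\<F>)"
        using that(2) unfolding S_def by blast
      moreover have "Z closure_of (\<Union>\<F>) \<subseteq> C"
        using V'(5) G(2,4) by (intro closure_of_minimal) auto
      ultimately show ?thesis
        using G(5) by blast
    qed
    moreover have "openin (prod_topology X Y) ((X interior_of S V \<F>) \<times> V)"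
      using \<B>(2)[OF V(1)] by (simp add: openin_prod_Times_iff)
    ultimately show False
      using not[of "(X interior_of S V \<F>) \<times> V"] V(2) by auto
  qed
  ultimately show ?thesis
    by (rule meager_in_subset_countable_Union)
qed

lemma topcontinuous_at_prod_topology_swap:
  assumes "topcontinuous_at (prod_topology Y X) Z (\<lambda>(y, x). f (x, y)) (y, x)"
  shows "topcontinuous_at (prod_topology X Y) Z f (x, y)"
  unfolding topcontinuous_at_def
proof (intro conjI allI impI)
  show "(x, y) \<in> topspace (prod_topology X Y)"
    "f \<in> topspace (prod_topology X Y) \<rightarrow> topspace Z"
    using assms unfolding topcontinuous_at_def by (auto simp: Pi_iff)
  fix W assume W: "openin Z W \<and> f (x, y) \<in> W"
  then obtain G where G: "openin (prod_topology Y X) G" "(y, x) \<in> G" "\<forall>(y, x)\<in>G. f (x, y) \<in> W"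
    using assms unfolding topcontinuous_at_def by (auto simp: case_prod_beta)
  have "continuous_map (prod_topology X Y) (prod_topology Y X) (\<lambda>p. (snd p, fst p))"
    by (intro continuous_map_pairedI continuous_map_fst continuous_map_snd)
  from openin_continuous_map_preimage[OF this G(1)]
  have "openin (prod_topology X Y) {p \<in> topspace (prod_topology X Y). (snd p, fst p) \<in> G}" .
  moreover have "x \<in> topspace X" "y \<in> topspace Y"
    using assms unfolding topcontinuous_at_def by auto
  ultimately show "\<exists>U. openin (prod_topology X Y) U \<and> (x, y) \<in> U \<and> (\<forall>p\<in>U. f p \<in> W)"
    using G(2,3)
    by (intro exI[of _ "{p \<in> topspace (prod_topology X Y). (snd p, fst p) \<in> G}"]) auto
qed

lemma topcontinuous_at_subtopologyD:
  assumes f: "topcontinuous_at X (subtopology Z B) f x"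
  shows "topcontinuous_at X Z f x"
  unfolding topcontinuous_at_def
proof (intro conjI allI impI)
  show "x \<in> topspace X" and Z: "f \<in> topspace X \<rightarrow> topspace Z"
    using f unfolding topcontinuous_at_def by auto
  fix W assume W: "openin Z W \<and> f x \<in> W"
  then have "openin (subtopology Z B) (B \<inter> W)"
    using openin_subtopology_Int2 by blast
  moreover have "f x \<in> B \<inter> W"
    using f W unfolding topcontinuous_at_def by auto
  ultimately show "\<exists>U. openin X U \<and> x \<in> U \<and> (\<forall>y\<in>U. f y \<in> W)"
    using f unfolding topcontinuous_at_def by (meson IntD2)
qed

lemma aleph0_monolithic_imp_CC_Maslyuchenko:
  fixes Z :: "'z topology"
  assumes Z: "aleph0_monolithic_space Z"
  shows "CC_Maslyuchenko TYPE('x) TYPE('y) Z"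
  unfolding CC_Maslyuchenko_def
proof (intro allI impI)
  fix X :: "'x topology" and Y :: "'y topology" and f :: "'x \<times> 'y \<Rightarrow> 'z"
  assume "separable_space X \<and> metrizable_space X \<and>
    separable_space Y \<and> metrizable_space Y \<and> separately_continuous_map X Y Z f"
  then have X: "separable_space X" "metrizable_space X"
    and Y: "separable_space Y" "metrizable_space Y"
    and f: "separately_continuous_map X Y Z f"
    by simp_all
  obtain A where A: "countable A" "A \<subseteq> topspace Z"
    "f ` (topspace X \<times> topspace Y) \<subseteq> sequential_closure_of Z (sequential_closure_of Z A)"
    using separately_continuous_range[OF X Y f] .
  define B where "B = sequential_closure_of Z (sequential_closure_of Z A)"
  have fB: "f (x, y) \<in> B" if "x \<in> topspace X" "y \<in> topspace Y" for x y
    using that A(3) unfolding B_def by blast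
  have BZ: "B \<subseteq> topspace Z"
    unfolding B_def by (rule sequential_closure_of_subset_topspace)
  have "aleph0_space (subtopology Z A)"
    using Z A(1,2) unfolding aleph0_monolithic_space_def by simp
  moreover have closure: "aleph0_space (subtopology Z (sequential_closure_of Z A'))"
    if "A' \<subseteq> topspace Z" "aleph0_space (subtopology Z A')" for A'
    using Z that unfolding aleph0_monolithic_space_def by simp
  ultimately have "aleph0_space (subtopology Z B)"
    unfolding B_def by (intro closure sequential_closure_of_subset_topspace A(2))
  then obtain \<N> where reg: "regular_space (subtopology Z B)"
    and N: "k_network (subtopology Z B) \<N>" "countable \<N>"
    unfolding aleph0_space_def regular_Hausdorff_space_def by blast
  have f1: "continuous_map Y (subtopology Z B) (\<lambda>y. f (x, y))" if "x \<in> topspace X" for x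
    using f that fB unfolding separately_continuous_map_def
    by (auto simp: continuous_map_in_subtopology)
  have f2: "continuous_map X (subtopology Z B) (\<lambda>x. f (x, y))" if "y \<in> topspace Y" for y
    using f that fB unfolding separately_continuous_map_def
    by (auto simp: continuous_map_in_subtopology)
  have first: "meager_in X {x \<in> topspace X. \<exists>y\<in>topspace Y.
      \<not> topcontinuous_at (prod_topology X Y) (subtopology Z B) (\<lambda>(x, y). f (x, y)) (x, y)}"
      (is "meager_in X ?M")
    using separable_metrizable_imp_second_countable[OF Y] f1 f2
    by (rule joint_continuity_off_meager_set[OF reg N])
  have second: "meager_in Y {y \<in> topspace Y. \<exists>x\<in>topspace X.
      \<not> topcontinuous_at (prod_topology Y X) (subtopology Z B) (\<lambda>(y, x). f (x, y)) (y, x)}"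
      (is "meager_in Y ?N")
    using separable_metrizable_imp_second_countable[OF X] f2 f1
    by (rule joint_continuity_off_meager_set[OF reg N])
  have disc: "x \<in> ?M" "y \<in> ?N" if "(x, y) \<in> discontinuity_points (prod_topology X Y) Z f" for x y
  proof -
    have xy: "x \<in> topspace X" "y \<in> topspace Y"
      and discont: "\<not> topcontinuous_at (prod_topology X Y) Z f (x, y)"
      using that unfolding discontinuity_points_def by auto
    have not: "\<not> topcontinuous_at (prod_topology X Y) (subtopology Z B) f (x, y)"
      using discont by (rule contrapos_nn) (rule topcontinuous_at_subtopologyD)
    then show "x \<in> ?M"
      using xy by auto
    have "\<not> topcontinuous_at (prod_topology Y X) (subtopology Z B) (\<lambda>(y, x). f (x, y)) (y, x)"
      using not by (rule contrapos_nn) (rule topcontinuous_at_prod_topology_swap)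
    then show "y \<in> ?N"
      using xy by blast
  qed
  have "fst ` discontinuity_points (prod_topology X Y) Z f \<subseteq> ?M"
    using disc(1) by auto
  moreover have "snd ` discontinuity_points (prod_topology X Y) Z f \<subseteq> ?N"
    using disc(2) by auto
  ultimately show "meager_in X (fst ` discontinuity_points (prod_topology X Y) Z f) \<and>
    meager_in Y (snd ` discontinuity_points (prod_topology X Y) Z f)"
    using meager_in_subset[OF first] meager_in_subset[OF second] by blast
qed

theorem corollary5p4:
  fixes Z :: "'z topology"
  shows "(aleph0_monolithic_space Z \<longrightarrow> CC_Maslyuchenko TYPE('x) TYPE('y) Z) \<and>
         (k_star_metrizable_space Z \<longrightarrow> CC_Maslyuchenko TYPE('x) TYPE('y) Z) \<and>
         (aleph_space Z \<longrightarrow> CC_Maslyuchenko TYPE('x) TYPE('y) Z)"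
  using aleph0_monolithic_imp_CC_Maslyuchenko k_star_metrizable_imp_aleph0_monolithic
    aleph_imp_k_star_metrizable by blast

end
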